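(* Let $L_n$ denote the size of the largest block in a uniformly random non-crossing partition of $[n]=\{1,\dots,n\}$. Then, as $n\to\infty$, $$\frac{L_n}{\log_2 n}\longrightarrow 1\quad\text{in probability}.$$
   Context: A partition of $[n]=\{1,\dots,n\}$ into (nonempty) subsets, called blocks, is non-crossing if there are no elements $a<b<c<d$ such that $a$ and $c$ lie in one block and $b$ and $d$ lie in a different block. A random non-crossing partition of $[n]$ is one chosen uniformly from the finite set of all non-crossing partitions of $[n]$. The size of a block is its number of elements. *)

theory Defs
  imports "HOL-Probability.Probability" "HOL-Library.Disjoint_Sets"
begin

definition noncrossing :: "nat set set \<Rightarrow> bool" where
  "noncrossing P \<longleftrightarrow>
     \<not> (\<exists>A\<in>P. \<exists>B\<in>P. A \<noteq> B \<and>
          (\<exists>a b c d. a < b \<and> b < c \<and> c < d \<and> a \<in> A \<and> c \<in> A \<and> b \<in> B \<and> d \<in> B))"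

definition noncrossing_partitions :: "nat \<Rightarrow> nat set set set" where
  "noncrossing_partitions n = {P. partition_on {1..n} P \<and> noncrossing P}"

lemma finite_noncrossing_partitions: "finite (noncrossing_partitions n)"
  unfolding noncrossing_partitions_def
  by (rule finite_subset[OF _ finitely_many_partition_on[of "{1..n}"]]) auto

text \<open>Finiteness and nonemptiness are what makes \<^const>\<open>pmf_of_set\<close> below the
  uniform distribution.\<close>

lemma noncrossing_partitions_nonempty: "noncrossing_partitions n \<noteq> {}"
proof -
  have "(\<lambda>x. {x}) ` {1..n} \<in> noncrossing_partitions n"
    by (auto simp: noncrossing_partitions_def noncrossing_def partition_on_def disjoint_def)
  then show ?thesis by blast
qed

definition random_noncrossing_partition :: "nat \<Rightarrow> nat set set pmf" where
  "random_noncrossing_partition n = pmf_of_set (noncrossing_partitions n)"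

text \<open>Meaningful for \<open>n \<ge> 1\<close> only: the partition of the empty set has no block, so that
  \<^const>\<open>Max\<close> is unspecified.\<close>

definition largest_block_size :: "nat set set \<Rightarrow> nat" where
  "largest_block_size P = Max (card ` P)"

text \<open>Each variable \<open>X n\<close> lives on its own probability space \<open>M n\<close>, so this is only
  defined for a constant limit.\<close>

definition tendsto_in_probability ::
    "(nat \<Rightarrow> 'a measure) \<Rightarrow> (nat \<Rightarrow> 'a \<Rightarrow> real) \<Rightarrow> real \<Rightarrow> bool" where
  "tendsto_in_probability M X c \<longleftrightarrow>
     (\<forall>n. prob_space (M n) \<and> X n \<in> borel_measurable (M n)) \<and>
     (\<forall>\<epsilon>>0. (\<lambda>n. measure (M n) {\<omega> \<in> space (M n). \<bar>X n \<omega> - c\<bar> > \<epsilon>}) \<longlonglongrightarrow> 0)"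

end

theory Submission
  imports Defs "HOL-Real_Asymp.Real_Asymp"
begin

text \<open>
  The proof replaces the random non-crossing partition by a uniformly random weak composition of
  \<open>n\<close> into \<open>n + 1\<close> parts, for which all the relevant probabilities are quotients of binomial
  coefficients.

  Write the size of each block at the position of its least element and \<open>0\<close> at the other positions
  of \<open>{1..n}\<close>. The elements up to \<open>m\<close> lie in blocks that have been opened by then, so the first \<open>m\<close>
  entries add up to at least \<open>m\<close>. Conversely, a sequence with this property and total \<open>n\<close> comes from
  exactly one non-crossing partition: the block opened last cannot contain gaps, as an element in a
  gap would belong to an earlier block and cause a crossing; hence it is an interval determined by
  its least element and its size, and it can be split off
  (\<open>noncrossing_determined_by_block_size_at\<close>, \<open>ballot_function_realized\<close>). After a final \<open>0\<close> is
  appended, these sequences are the lists of length \<open>n + 1\<close> and sum \<open>n\<close> that satisfy a ballot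
  condition. Every list of that length and sum has exactly one rotation that satisfies it
  (\<open>cycle_lemma\<close>), and rotation does not affect the set of entries. So the set of block sizes,
  together with \<open>0\<close>, has the law of the set of entries of a uniformly random list of length
  \<open>n + 1\<close> and sum \<open>n\<close> (\<open>card_noncrossing_partitions_by_sizes\<close>).

  A fixed entry of that list is at least \<open>k\<close> with probability
  \<open>p k = (2n - k choose n) / (2n choose n)\<close>. The quotients of consecutive binomial coefficients give
  \<open>p k \<le> 2 ^ (-k)\<close>, \<open>p k \<ge> 2 ^ (-k) * (1 - k\<^sup>2 / n)\<close> and \<open>p (2 * k) \<le> (p k)\<^sup>2\<close>. The union bound makes
  an entry of size \<open>(1 + \<delta>) * log 2 n\<close> unlikely. Two given entries are both at least \<open>k\<close> with
  probability \<open>p (2 * k)\<close>, so the events are negatively correlated, the number of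
  entries that are at least \<open>k\<close> has variance at most its mean \<open>(n + 1) * p k\<close>, and Chebyshev's
  inequality bounds the probability that there is no such entry by \<open>1 / ((n + 1) * p k)\<close>. For
  \<open>k\<close> about \<open>(1 - \<delta>) * log 2 n\<close> this is of order \<open>n powr (-\<delta>)\<close>.
\<close>

section \<open>Non-crossing partitions from the sizes of their blocks\<close>

text \<open>
  The sum stands for a case distinction: in a partition at most one block has least element \<open>i\<close>,
  so the value is the size of that block, or \<open>0\<close> if there is none.
\<close>
definition block_size_at :: "nat set set \<Rightarrow> nat \<Rightarrow> nat" where
  "block_size_at P i = (\<Sum>B | B \<in> P \<and> Min B = i. card B)"

text \<open>
  For \<open>S = {1..n}\<close> these are the sequences of block sizes described above. A general finite \<open>S\<close>
  allows induction by removal of a block, without relabelling the elements that remain.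
\<close>
definition ballot_functions :: "nat set \<Rightarrow> (nat \<Rightarrow> nat) set" where
  "ballot_functions S =
     {f. (\<forall>i. i \<notin> S \<longrightarrow> f i = 0) \<and> sum f S = card S \<and>
         (\<forall>m. card (S \<inter> {..m}) \<le> sum f (S \<inter> {..m}))}"

definition initial_segment :: "'a::linorder set \<Rightarrow> 'a set \<Rightarrow> bool" where
  "initial_segment B T \<longleftrightarrow> B \<subseteq> T \<and> (\<forall>y\<in>B. \<forall>x\<in>T. x \<le> y \<longrightarrow> x \<in> B)"

lemma initial_segment_unique:
  assumes "finite T" "initial_segment B T" "initial_segment C T" "card B = card C"
  shows "B = C"
proof -
  have "B \<subseteq> C \<or> C \<subseteq> B"
    using assms(2,3) unfolding initial_segment_def by (meson linear subset_iff)
  moreover have "finite B" "finite C"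
    using assms(1-3) by (auto simp: initial_segment_def intro: finite_subset)
  ultimately show ?thesis
    using assms(4) card_subset_eq by metis
qed

lemma initial_segment_exists:
  assumes "finite T" "k \<le> card T"
  shows "\<exists>B. initial_segment B T \<and> card B = k"
  using assms(2)
proof (induction k)
  case 0
  then show ?case by (intro exI[of _ "{}"]) (auto simp: initial_segment_def)
next
  case (Suc k)
  then obtain B where B: "initial_segment B T" "card B = k" by auto
  have fB: "finite B" using B(1) assms(1) finite_subset unfolding initial_segment_def by blast
  have ne: "T - B \<noteq> {}"
  proof
    assume "T - B = {}"
    then have "card T \<le> card B" using fB by (intro card_mono) auto
    then show False using Suc.prems B(2) by simp
  qed
  define x where "x = Min (T - B)"
  have x: "x \<in> T - B" "\<And>y. y \<in> T - B \<Longrightarrow> x \<le> y"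
    using ne assms(1) Min_in[of "T - B"] Min_le[of "T - B"] unfolding x_def by blast+
  have "initial_segment (insert x B) T"
    unfolding initial_segment_def
  proof (intro conjI ballI impI)
    show "insert x B \<subseteq> T" using B(1) x(1) by (auto simp: initial_segment_def)
    fix y z assume yz: "y \<in> insert x B" "z \<in> T" "z \<le> y"
    show "z \<in> insert x B"
    proof (cases "y = x")
      case True
      then show ?thesis using yz x(2)[of z] by force
    next
      case False
      then show ?thesis using yz B(1) unfolding initial_segment_def by blast
    qed
  qed
  moreover have "card (insert x B) = Suc k" using x fB B(2) by simp
  ultimately show ?case by blast
qed

lemma partition_block_facts:
  assumes "partition_on S P" "finite (S :: nat set)" "B \<in> P"
  shows "finite B" "B \<noteq> {}" "B \<subseteq> S" "Min B \<in> B"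
proof -
  show 1: "B \<subseteq> S" and 2: "B \<noteq> {}"
    using assms by (auto simp: partition_on_def)
  show 3: "finite B" using 1 assms(2) finite_subset by blast
  show "Min B \<in> B" using 2 3 by simp
qed

lemma inj_on_Min_partition:
  assumes "partition_on S P" "finite (S :: nat set)"
  shows "inj_on Min P"
proof (rule inj_onI)
  fix B C assume *: "B \<in> P" "C \<in> P" "Min B = Min C"
  then have "Min B \<in> B \<inter> C" using partition_block_facts(4)[OF assms] by force
  then show "B = C" using partition_onD2[OF assms(1)] * by (auto dest: disjointD)
qed

lemma block_size_at_Min:
  assumes "partition_on S P" "finite S" "B \<in> P"
  shows "block_size_at P (Min B) = card B"
proof -
  have "{C. C \<in> P \<and> Min C = Min B} = {B}"
    using inj_on_Min_partition[OF assms(1,2)] assms(3) by (auto dest: inj_onD)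
  then show ?thesis by (simp add: block_size_at_def)
qed

lemma block_size_at_eq_0: "i \<notin> Min ` P \<Longrightarrow> block_size_at P i = 0"
  by (auto simp: block_size_at_def intro!: sum.neutral)

lemma block_size_at_pos_iff:
  assumes "partition_on S P" "finite S"
  shows "block_size_at P i > 0 \<longleftrightarrow> i \<in> Min ` P"
proof
  assume "i \<in> Min ` P"
  then obtain B where "B \<in> P" "i = Min B" by auto
  then show "block_size_at P i > 0"
    using block_size_at_Min[OF assms] partition_block_facts[OF assms] by (simp add: card_gt_0_iff)
next
  assume "0 < block_size_at P i"
  then show "i \<in> Min ` P" using block_size_at_eq_0[of i P] by (cases "i \<in> Min ` P") auto
qed

text \<open>
  Partial sums of the sizes count the elements of all blocks opened so far; the ballot condition and
  the total are read off from this.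
\<close>
lemma sum_block_size_at:
  assumes "partition_on S P" "finite S"
  shows "sum (block_size_at P) (S \<inter> {..m}) = card (\<Union>{B\<in>P. Min B \<le> m})"
proof -
  have finP: "finite P" using assms finite_elements by blast
  note blk = partition_block_facts[OF assms]
  have "sum (block_size_at P) (S \<inter> {..m})
      = (\<Sum>i\<in>S \<inter> {..m}. \<Sum>B\<in>{B \<in> {B\<in>P. Min B \<le> m}. Min B = i}. card B)"
    by (intro sum.cong) (auto simp: block_size_at_def intro!: sum.cong)
  also have "\<dots> = (\<Sum>B\<in>{B\<in>P. Min B \<le> m}. card B)"
  proof (intro sum.group)
    show "Min ` {B\<in>P. Min B \<le> m} \<subseteq> S \<inter> {..m}" using blk(3,4) by blast
  qed (use finP assms(2) in auto)
  also have "\<dots> = card (\<Union>{B\<in>P. Min B \<le> m})"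
    using assms(1) blk
    by (intro card_Union_disjoint[symmetric])
       (auto simp: partition_on_def pairwise_def disjoint_def disjnt_def)
  finally show ?thesis .
qed

lemma block_size_at_in_ballot_functions:
  assumes "partition_on S P" "finite S"
  shows "block_size_at P \<in> ballot_functions S"
proof -
  note blk = partition_block_facts[OF assms]
  have US: "\<Union>P = S" using assms(1) by (simp add: partition_on_def)
  have 1: "block_size_at P i = 0" if "i \<notin> S" for i
    using that blk by (intro block_size_at_eq_0) blast
  have 2: "card (S \<inter> {..m}) \<le> sum (block_size_at P) (S \<inter> {..m})" for m
    unfolding sum_block_size_at[OF assms]
  proof (rule card_mono)
    have "\<Union>{B \<in> P. Min B \<le> m} \<subseteq> S" using US by auto
    then show "finite (\<Union>{B \<in> P. Min B \<le> m})" using assms(2) finite_subset by blast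
    show "S \<inter> {..m} \<subseteq> \<Union>{B \<in> P. Min B \<le> m}"
    proof
      fix x assume x: "x \<in> S \<inter> {..m}"
      then obtain B where B: "B \<in> P" "x \<in> B" using US by auto
      then have "Min B \<le> m" using blk(1)[OF B(1)] x by (meson IntD2 Min_le atMost_iff le_trans)
      then show "x \<in> \<Union>{B \<in> P. Min B \<le> m}" using B by auto
    qed
  qed
  have 3: "sum (block_size_at P) S = card S"
  proof -
    obtain m where m: "S \<subseteq> {..m}" using assms(2) finite_nat_iff_bounded_le by blast
    then have "S \<inter> {..m} = S" by auto
    moreover have "{B\<in>P. Min B \<le> m} = P" using blk m by blast
    ultimately show ?thesis using sum_block_size_at[OF assms, of m] US by simp
  qed
  show ?thesis using 1 2 3 by (simp add: ballot_functions_def)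
qed

lemma noncrossing_subset: "noncrossing P \<Longrightarrow> Q \<subseteq> P \<Longrightarrow> noncrossing Q"
  unfolding noncrossing_def by (meson subsetD)

lemma partition_remove_block:
  assumes "partition_on S P" "B \<in> P"
  shows "partition_on (S - B) (P - {B})"
proof -
  have "disjnt B (\<Union>(P - {B}))"
    using partition_onD2[OF assms(1)] assms(2) by (auto simp: disjnt_def dest: disjointD)
  moreover have "insert B (P - {B}) = P" using assms(2) by auto
  ultimately show ?thesis using partition_on_insert[of B "P - {B}" S] assms(1) by simp
qed

lemma block_size_at_remove_block:
  assumes "partition_on S P" "finite S" "B \<in> P"
  shows "block_size_at (P - {B}) = (block_size_at P)(Min B := 0)"
proof
  fix i
  show "block_size_at (P - {B}) i = ((block_size_at P)(Min B := 0)) i"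
  proof (cases "i = Min B")
    case True
    then show ?thesis
      using inj_on_Min_partition[OF assms(1,2)] assms(3)
      by (auto dest: inj_onD intro!: block_size_at_eq_0)
  next
    case False
    then have "{C. C \<in> P - {B} \<and> Min C = i} = {C. C \<in> P \<and> Min C = i}" by auto
    then show ?thesis using False by (simp add: block_size_at_def)
  qed
qed

text \<open>
  An element \<open>x\<close> skipped by the block \<open>B\<close> with the largest minimum would lie in a block \<open>C\<close> opened
  earlier, and then \<open>Min C < Min B < x < y\<close> is a crossing. So \<open>B\<close> is recovered from its minimum
  and its size alone.
\<close>
lemma last_block_initial_segment:
  assumes P: "partition_on S P" "finite S" "noncrossing P"
    and B: "B \<in> P" "\<And>C. C \<in> P \<Longrightarrow> Min C \<le> Min B"
  shows "initial_segment B (S \<inter> {Min B..})"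
  unfolding initial_segment_def
proof (intro conjI ballI impI)
  note blk = partition_block_facts[OF P(1,2)]
  show "B \<subseteq> S \<inter> {Min B..}" using blk[OF B(1)] by auto
  fix y x assume y: "y \<in> B" and x: "x \<in> S \<inter> {Min B..}" and xy: "x \<le> y"
  show "x \<in> B"
  proof (rule ccontr)
    assume nx: "x \<notin> B"
    obtain C where C: "C \<in> P" "x \<in> C" using x P(1) by (auto simp: partition_on_def)
    have "C \<noteq> B" using nx C by auto
    then have "Min C \<noteq> Min B"
      using inj_on_Min_partition[OF P(1,2)] C(1) B(1) by (auto dest: inj_onD)
    then have "Min C < Min B" using B(2)[OF C(1)] by simp
    moreover have "Min B < x" "x < y"
      using x xy nx y blk(4)[OF B(1)] by (auto simp: order_less_le)
    moreover have "Min C \<in> C" "Min B \<in> B" using blk(4) B(1) C(1) by auto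
    ultimately show False
      using P(3) \<open>C \<noteq> B\<close> C B(1) y unfolding noncrossing_def by metis
  qed
qed

text \<open>
  The position of the last non-zero size is the minimum of the block opened last, which is thus the
  same in both partitions; the rest follows by induction after its removal.
\<close>
lemma noncrossing_determined_by_block_size_at:
  assumes "finite S" "partition_on S P" "noncrossing P" "partition_on S Q" "noncrossing Q"
    and "block_size_at P = block_size_at Q"
  shows "P = Q"
  using assms
proof (induction "card S" arbitrary: S P Q rule: less_induct)
  case less
  note P = less.prems(2,1,3) and Q = less.prems(4,1,5)
  have MinPQ: "Min ` P = Min ` Q"
    using block_size_at_pos_iff[OF P(1,2)] block_size_at_pos_iff[OF Q(1,2)] less.prems(6) by auto
  show ?case
  proof (cases "S = {}")
    case True
    then show ?thesis using P Q by (simp add: partition_on_empty)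
  next
    case False
    have "P \<noteq> {}" using False P(1) by (auto simp: partition_on_def)
    moreover have "finite P" using P finite_elements by blast
    ultimately have "Max (Min ` P) \<in> Min ` P" and mx: "\<And>C. C \<in> P \<Longrightarrow> Min C \<le> Max (Min ` P)"
      by auto
    then obtain B where B: "B \<in> P" "Max (Min ` P) = Min B" by auto
    obtain C where C: "C \<in> Q" "Min C = Min B" using B MinPQ by (metis imageE image_eqI)
    have sB: "initial_segment B (S \<inter> {Min B..})"
      using P B mx by (intro last_block_initial_segment) auto
    have "Min D \<le> Min C" if "D \<in> Q" for D
    proof -
      have "Min D \<in> Min ` P" using that MinPQ by simp
      then obtain E where "E \<in> P" "Min E = Min D" by auto
      then show ?thesis using mx[of E] B(2) C(2) by simp
    qed
    then have sC: "initial_segment C (S \<inter> {Min B..})"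
      using last_block_initial_segment[OF Q C(1)] C(2) by simp
    have "card B = card C"
      using block_size_at_Min[OF P(1,2) B(1)] block_size_at_Min[OF Q(1,2) C(1)] C(2) less.prems(6) by simp
    then have BC: "B = C"
      using initial_segment_unique[OF _ sB sC] P(2) by simp
    have nc: "noncrossing (P - {B})" "noncrossing (Q - {B})"
      by (rule noncrossing_subset[OF P(3)], simp) (rule noncrossing_subset[OF Q(3)], simp)
    have blk: "finite B" "B \<noteq> {}" "B \<subseteq> S" by (rule partition_block_facts[OF P(1,2) B(1)])+
    have "card (S - B) < card S"
      using blk P(2) by (intro psubset_card_mono) auto
    then have "P - {B} = Q - {B}"
    proof (rule less.hyps)
      show "partition_on (S - B) (P - {B})" "partition_on (S - B) (Q - {B})"
        using partition_remove_block P(1) Q(1) B(1) C(1) BC by auto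
      show "block_size_at (P - {B}) = block_size_at (Q - {B})"
        using block_size_at_remove_block[OF P(1,2) B(1)]
          block_size_at_remove_block[OF Q(1,2), of B] C(1) BC less.prems(6) by simp
    qed (use P(2) nc in auto)
    then show ?thesis using B(1) C(1) BC by blast
  qed
qed

text \<open>
  A set without gaps, relative to \<open>S\<close>, cannot cross a block disjoint from it, whichever of the two
  plays the part of the first block in the definition of a crossing.
\<close>
lemma insert_segment_block:
  assumes P: "partition_on (S - B) P" "noncrossing P"
    and B: "initial_segment B (S \<inter> {i..})" "B \<noteq> {}"
  shows "partition_on S (insert B P)" "noncrossing (insert B P)"
proof -
  have BS: "B \<subseteq> S" using B by (auto simp: initial_segment_def)
  have UP: "\<Union>P = S - B" using P by (simp add: partition_on_def)
  show "partition_on S (insert B P)"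
    using partition_on_insert[of B P S] P(1) BS B(2) UP by (auto simp: disjnt_def)
  have conv: "y \<in> B" if "x \<in> B" "z \<in> B" "x < y" "y < z" "y \<in> S" for x y z
  proof -
    have "i \<le> x" using that(1) B(1) by (auto simp: initial_segment_def)
    then have "y \<in> S \<inter> {i..}" using that by simp
    then show ?thesis using that(2,4) B(1) unfolding initial_segment_def by auto
  qed
  have outside: "\<And>C x. C \<in> P \<Longrightarrow> x \<in> C \<Longrightarrow> x \<in> S \<and> x \<notin> B" using UP by auto
  show "noncrossing (insert B P)"
    unfolding noncrossing_def
  proof clarify
    fix A C a b c d
    assume *: "A \<in> insert B P" "C \<in> insert B P" "A \<noteq> C" "a < b" "b < c" "c < d"
      "a \<in> A" "c \<in> A" "b \<in> C" "d \<in> (C :: nat set)"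
    consider "A = B" "C \<in> P" | "A \<in> P" "C = B" | "A \<in> P" "C \<in> P" using * by auto
    then show False
    proof cases
      case 1
      then show ?thesis using conv[of a c b] outside * by blast
    next
      case 2
      then show ?thesis using conv[of b d c] outside * by blast
    next
      case 3
      then show ?thesis using * P(2) unfolding noncrossing_def by metis
    qed
  qed
qed

text \<open>
  The inverse construction: at the last position \<open>i\<close> with \<open>f i > 0\<close>, take the next \<open>f i\<close> elements
  of \<open>S\<close> from \<open>i\<close> on as a block. There are enough of them since, by the ballot condition
  below \<open>i\<close> and the total, the elements from \<open>i\<close> on number at least \<open>f i\<close>.
\<close>
lemma ballot_function_realized:
  assumes "finite S" "f \<in> ballot_functions S"
  shows "\<exists>P. partition_on S P \<and> noncrossing P \<and> block_size_at P = f"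
  using assms
proof (induction "card S" arbitrary: S f rule: less_induct)
  case less
  note S = less.prems(1)
  have supp: "\<And>i. i \<notin> S \<Longrightarrow> f i = 0" and tot: "sum f S = card S"
    and bal: "\<And>m. card (S \<inter> {..m}) \<le> sum f (S \<inter> {..m})"
    using less.prems(2) by (auto simp: ballot_functions_def)
  show ?case
  proof (cases "S = {}")
    case True
    have "block_size_at {} = f" using supp True by (auto simp: block_size_at_def)
    then show ?thesis using True by (intro exI[of _ "{}"]) (auto simp: partition_on_empty noncrossing_def)
  next
    case False
    define T where "T = {i\<in>S. f i > 0}"
    have T: "finite T" "T \<noteq> {}"
    proof -
      show "finite T" using S by (simp add: T_def)
      show "T \<noteq> {}"
      proof
        assume "T = {}"
        then have "sum f S = 0" by (intro sum.neutral) (auto simp: T_def)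
        then show False using tot False S by simp
      qed
    qed
    define i where "i = Max T"
    have i: "i \<in> S" "f i > 0" and imax: "\<And>j. j > i \<Longrightarrow> f j = 0"
    proof -
      have "i \<in> T" using T by (simp add: i_def)
      then show "i \<in> S" "f i > 0" by (auto simp: T_def)
      fix j assume "j > i"
      then have "j \<notin> T" using T by (auto simp: i_def)
      then show "f j = 0" using supp by (auto simp: T_def)
    qed
    have below: "card (S \<inter> {..<i}) \<le> sum f (S \<inter> {..<i})"
    proof (cases i)
      case (Suc j)
      then show ?thesis using bal[of j] by (simp add: lessThan_Suc_atMost)
    qed simp
    have "sum f S = sum f (insert i (S \<inter> {..<i}))"
    proof (intro sum.mono_neutral_right ballI)
      fix j assume "j \<in> S - insert i (S \<inter> {..<i})"
      then have "i < j" by auto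
      then show "f j = 0" by (rule imax)
    qed (use S i in auto)
    then have split_f: "sum f S = f i + sum f (S \<inter> {..<i})" using S by simp
    have "card S = card (S \<inter> {..<i} \<union> S \<inter> {i..})" by (rule arg_cong[where f=card]) auto
    also have "\<dots> = card (S \<inter> {..<i}) + card (S \<inter> {i..})"
      using S by (intro card_Un_disjoint) auto
    finally have "f i \<le> card (S \<inter> {i..})" using split_f below tot by linarith
    then obtain B where B: "initial_segment B (S \<inter> {i..})" "card B = f i"
      using initial_segment_exists S by (metis finite_Int)
    have BS: "B \<subseteq> S" "finite B" "B \<noteq> {}"
      using B i S finite_subset[of B S] by (auto simp: initial_segment_def)
    have iB: "i \<in> B" using BS(3) B(1) i(1) unfolding initial_segment_def by auto
    have MinB: "Min B = i"
      using iB BS B(1) by (intro Min_eqI) (auto simp: initial_segment_def)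
    define g where "g = f(i := 0)"
    have gB: "g x = 0" if "x \<in> B" for x
      using that imax[of x] B(1) by (auto simp: g_def initial_segment_def)
    have sum_g: "sum g (S - B) = card (S - B)"
    proof -
      have "sum g S = sum g (S - {i})"
        using S i by (simp add: sum.remove[of S i] g_def)
      also have "\<dots> = sum f (S - {i})" by (intro sum.cong) (auto simp: g_def)
      finally have "f i + sum g S = card S" using sum.remove[OF S i(1), of f] tot by simp
      moreover have "sum g (S - B) = sum g S"
        using S BS gB by (intro sum.mono_neutral_left) auto
      moreover have "card (S - B) = card S - f i" using BS B(2) by (simp add: card_Diff_subset)
      ultimately show ?thesis by simp
    qed
    have "g \<in> ballot_functions (S - B)"
      unfolding ballot_functions_def
    proof (intro CollectI conjI allI impI sum_g)
      fix x assume "x \<notin> S - B"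
      then show "g x = 0" using gB[of x] supp[of x] by (cases "x \<in> B") (auto simp: g_def)
    next
      fix m
      show "card ((S - B) \<inter> {..m}) \<le> sum g ((S - B) \<inter> {..m})"
      \<comment> \<open>Below \<open>i\<close> nothing has changed; from \<open>i\<close> on the partial sum of \<open>g\<close> already is its total.\<close>
      proof (cases "m < i")
        case True
        have "(S - B) \<inter> {..m} = S \<inter> {..m}" using True B(1) by (auto simp: initial_segment_def)
        moreover have "sum g (S \<inter> {..m}) = sum f (S \<inter> {..m})"
          using True by (intro sum.cong) (auto simp: g_def)
        ultimately show ?thesis using bal by simp
      next
        case False
        have "card ((S - B) \<inter> {..m}) \<le> card (S - B)" using S by (intro card_mono) auto
        also have "\<dots> = sum g ((S - B) \<inter> {..m})"
          unfolding sum_g[symmetric]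
        proof (intro sum.mono_neutral_right ballI)
          fix j assume "j \<in> S - B - (S - B) \<inter> {..m}"
          then have "i < j" using False by auto
          then show "g j = 0" using imax by (simp add: g_def)
        qed (use S in auto)
        finally show ?thesis .
      qed
    qed
    moreover have "card (S - B) < card S" using BS S by (intro psubset_card_mono) auto
    ultimately obtain P where P: "partition_on (S - B) P" "noncrossing P" "block_size_at P = g"
      using less.hyps[of "S - B" g] S by auto
    note ins = insert_segment_block[OF P(1,2) B(1) BS(3)]
    have "B \<notin> P" using P(1) BS(3) by (auto simp: partition_on_def)
    then have "g = (block_size_at (insert B P))(i := 0)"
      using block_size_at_remove_block[OF ins(1) S, of B] MinB P(3) by simp
    moreover have "block_size_at (insert B P) i = f i"
      using block_size_at_Min[OF ins(1) S, of B] MinB B(2) by simp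
    ultimately have "block_size_at (insert B P) = f"
      unfolding g_def by (metis fun_upd_idem_iff fun_upd_upd)
    then show ?thesis using ins by blast
  qed
qed

lemma bij_betw_block_size_at:
  "bij_betw block_size_at (noncrossing_partitions n) (ballot_functions {1..n})"
  unfolding bij_betw_def
proof
  show "inj_on block_size_at (noncrossing_partitions n)"
    using noncrossing_determined_by_block_size_at[of "{1..n}"]
    by (auto simp: noncrossing_partitions_def inj_on_def)
  show "block_size_at ` noncrossing_partitions n = ballot_functions {1..n}"
  proof
    show "block_size_at ` noncrossing_partitions n \<subseteq> ballot_functions {1..n}"
      using block_size_at_in_ballot_functions[of "{1..n}"]
      by (auto simp: noncrossing_partitions_def)
    show "ballot_functions {1..n} \<subseteq> block_size_at ` noncrossing_partitions n"
    proof
      fix f assume "f \<in> ballot_functions {1..n}"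
      then show "f \<in> block_size_at ` noncrossing_partitions n"
        using ballot_function_realized[of "{1..n}" f]
        by (auto simp: noncrossing_partitions_def image_iff)
    qed
  qed
qed

section \<open>Ballot lists\<close>

definition weak_compositions :: "nat \<Rightarrow> nat \<Rightarrow> nat list set" where
  "weak_compositions N n = {xs. length xs = N \<and> sum_list xs = n}"

lemma finite_weak_compositions: "finite (weak_compositions N n)"
proof (rule finite_subset)
  show "weak_compositions N n \<subseteq> {xs. set xs \<subseteq> {..n} \<and> length xs = N}"
    by (auto simp: weak_compositions_def intro: member_le_sum_list)
qed (simp add: finite_lists_length_eq)

lemma card_weak_compositions: "card (weak_compositions N n) = (n + N - 1) choose n"
  unfolding weak_compositions_def by (rule card_length_sum_list)

definition ballot_lists :: "nat \<Rightarrow> nat list set" where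
  "ballot_lists n = {xs \<in> weak_compositions (Suc n) n. \<forall>j\<le>n. j \<le> sum_list (take j xs)}"

text \<open>
  The list has \<open>n + 1\<close> entries: the values at \<open>1\<close>, ..., \<open>n\<close>, followed by the value at \<open>n + 1\<close>, which is
  \<open>0\<close> for the functions in question. The additional entry brings the length to one more than the
  sum, as the cycle lemma requires.
\<close>
definition list_of_sizes :: "nat \<Rightarrow> (nat \<Rightarrow> nat) \<Rightarrow> nat list" where
  "list_of_sizes n f = map f [1..<n + 2]"

lemma sum_list_take_list_of_sizes:
  assumes "j \<le> Suc n"
  shows "sum_list (take j (list_of_sizes n f)) = sum f {1..j}"
proof -
  have "take j (list_of_sizes n f) = map f [1..<1 + j]"
    using assms unfolding list_of_sizes_def take_map by (subst take_upt) auto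
  then show ?thesis
    by (simp add: interv_sum_list_conv_sum_set_nat atLeastLessThanSuc_atLeastAtMost del: upt_Suc)
qed

lemma bij_betw_list_of_sizes:
  "bij_betw (list_of_sizes n) (ballot_functions {1..n}) (ballot_lists n)"
  unfolding bij_betw_def
proof
  show "inj_on (list_of_sizes n) (ballot_functions {1..n})"
  proof (rule inj_onI)
    fix f g assume f: "f \<in> ballot_functions {1..n}" and g: "g \<in> ballot_functions {1..n}"
      and eq: "list_of_sizes n f = list_of_sizes n g"
    show "f = g"
    proof
      fix i show "f i = g i"
      proof (cases "i \<in> {1..n}")
        case True
        then have "i \<in> set [1..<n + 2]" by auto
        then show ?thesis using eq unfolding list_of_sizes_def map_eq_conv by blast
      qed (use f g in \<open>simp add: ballot_functions_def\<close>)
    qed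
  qed
  show "list_of_sizes n ` ballot_functions {1..n} = ballot_lists n"
  proof
    show "list_of_sizes n ` ballot_functions {1..n} \<subseteq> ballot_lists n"
    proof (rule image_subsetI)
      fix f assume f: "f \<in> ballot_functions {1..n}"
      have len: "length (list_of_sizes n f) = Suc n" by (simp add: list_of_sizes_def)
      have "sum f {1..Suc n} = n" using f by (simp add: ballot_functions_def)
      then have "sum_list (list_of_sizes n f) = n"
        using sum_list_take_list_of_sizes[of "Suc n" n f] len by simp
      moreover have "j \<le> sum_list (take j (list_of_sizes n f))" if "j \<le> n" for j
      proof -
        have "{1..n} \<inter> {..j} = {1..j}" using that by auto
        moreover have "card ({1..n} \<inter> {..j}) \<le> sum f ({1..n} \<inter> {..j})"
          using f unfolding ballot_functions_def by blast
        ultimately have "card {1..j} \<le> sum f {1..j}" by (simp only:)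
        then show ?thesis using sum_list_take_list_of_sizes[of j n f] that by simp
      qed
      ultimately show "list_of_sizes n f \<in> ballot_lists n"
        using len by (simp add: ballot_lists_def weak_compositions_def)
    qed
    show "ballot_lists n \<subseteq> list_of_sizes n ` ballot_functions {1..n}"
    proof
      fix xs assume xs: "xs \<in> ballot_lists n"
      then have len: "length xs = Suc n" and tot: "sum_list xs = n"
        and bal: "\<And>j. j \<le> n \<Longrightarrow> j \<le> sum_list (take j xs)"
        by (auto simp: ballot_lists_def weak_compositions_def)
      have split: "sum_list xs = sum_list (take n xs) + xs ! n"
        using arg_cong[OF take_Suc_conv_app_nth[of n xs], of sum_list] len by simp
      \<comment> \<open>The first \<open>n\<close> entries already add up to \<open>n\<close>, so nothing is left for the last one.\<close>
      then have last: "xs ! n = 0" using bal[of n] tot by simp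
      define f where "f = (\<lambda>i. if i \<in> {1..n} then xs ! (i - 1) else 0)"
      have eq: "list_of_sizes n f = xs"
      proof (rule nth_equalityI)
        fix i assume "i < length (list_of_sizes n f)"
        then have "i < Suc n" by (simp add: list_of_sizes_def del: upt_Suc)
        then have "list_of_sizes n f ! i = f (Suc i)"
          unfolding list_of_sizes_def by (subst nth_map) (auto simp del: upt_Suc)
        then show "list_of_sizes n f ! i = xs ! i"
          using \<open>i < Suc n\<close> last by (auto simp: f_def less_Suc_eq)
      qed (simp add: list_of_sizes_def len del: upt_Suc)
      have part: "sum f {1..j} = sum_list (take j xs)" if "j \<le> Suc n" for j
        using sum_list_take_list_of_sizes[OF that, of f] eq by simp
      have "f \<in> ballot_functions {1..n}"
        unfolding ballot_functions_def
      proof (intro CollectI conjI allI impI)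
        show "f i = 0" if "i \<notin> {1..n}" for i using that unfolding f_def by auto
        have "sum f {1..n} = n" using part[of n] tot last split by simp
        then show "sum f {1..n} = card {1..n}" by simp
        show "card ({1..n} \<inter> {..m}) \<le> sum f ({1..n} \<inter> {..m})" for m
        proof -
          have "{1..n} \<inter> {..m} = {1..min n m}" by auto
          then show ?thesis using part[of "min n m"] bal[of "min n m"] by simp
        qed
      qed
      then show "xs \<in> list_of_sizes n ` ballot_functions {1..n}" using eq by blast
    qed
  qed
qed

definition block_size_list :: "nat \<Rightarrow> nat set set \<Rightarrow> nat list" where
  "block_size_list n P = list_of_sizes n (block_size_at P)"

lemma bij_betw_block_size_list:
  "bij_betw (block_size_list n) (noncrossing_partitions n) (ballot_lists n)"
proof -
  have "block_size_list n = list_of_sizes n \<circ> block_size_at"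
    by (simp add: fun_eq_iff block_size_list_def)
  then show ?thesis
    using bij_betw_trans[OF bij_betw_block_size_at bij_betw_list_of_sizes] by simp
qed

text \<open>
  Rotation preserves the set of entries, so this set is what carries the block sizes over to
  arbitrary weak compositions. The added \<open>0\<close> comes from the last position at the latest.
\<close>
lemma set_block_size_list:
  assumes "P \<in> noncrossing_partitions n"
  shows "set (block_size_list n P) = insert 0 (card ` P)"
proof -
  have P: "partition_on {1..n} P" and fin: "finite {1..n}"
    using assms by (auto simp: noncrossing_partitions_def)
  have S: "set (block_size_list n P) = block_size_at P ` {1..Suc n}"
    by (auto simp: block_size_list_def list_of_sizes_def simp del: upt_Suc)
  show ?thesis
  proof
    show "set (block_size_list n P) \<subseteq> insert 0 (card ` P)"
      unfolding S
    proof (rule image_subsetI)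
      fix i
      show "block_size_at P i \<in> insert 0 (card ` P)"
        using block_size_at_Min[OF P fin] block_size_at_eq_0[of i P]
        by (cases "i \<in> Min ` P") auto
    qed
    have "Suc n \<notin> Min ` P" using partition_block_facts(3,4)[OF P fin] by fastforce
    then have "block_size_at P (Suc n) = 0" by (rule block_size_at_eq_0)
    moreover have "card B \<in> block_size_at P ` {1..Suc n}" if "B \<in> P" for B
    proof
      show "card B = block_size_at P (Min B)" using block_size_at_Min[OF P fin that] by simp
      show "Min B \<in> {1..Suc n}" using partition_block_facts(3,4)[OF P fin that] by fastforce
    qed
    ultimately show "insert 0 (card ` P) \<subseteq> set (block_size_list n P)"
      unfolding S by (auto simp: image_iff intro!: bexI[of _ "Suc n"])
  qed
qed

section \<open>The cycle lemma\<close>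

lemma sum_list_rotate: "sum_list (rotate r xs) = (sum_list xs :: 'a::comm_monoid_add)"
proof (induction r)
  case (Suc r)
  then show ?case by (cases "rotate r xs") (simp_all add: add.commute)
qed simp

text \<open>
  The case distinction is whether the window of \<open>j\<close> entries that starts at position \<open>r\<close> wraps around.
  The sum of the first \<open>r\<close> entries is moved to the left to avoid truncated subtraction.
\<close>
lemma sum_list_take_rotate:
  fixes xs :: "nat list"
  assumes "r < length xs" "j < length xs"
  shows "sum_list (take j (rotate r xs)) + sum_list (take r xs) =
    (if r + j < length xs then sum_list (take (r + j) xs)
     else sum_list xs + sum_list (take (r + j - length xs) xs))"
proof -
  have rot: "rotate r xs = drop r xs @ take r xs" using assms by (simp add: rotate_drop_take)
  have xs: "sum_list xs = sum_list (take r xs) + sum_list (drop r xs)"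
    by (metis append_take_drop_id sum_list_append)
  show ?thesis
  proof (cases "r + j < length xs")
    case True
    then show ?thesis by (simp add: rot take_add)
  next
    case False
    then have "min (j - (length xs - r)) r = r + j - length xs" using assms by auto
    then show ?thesis using False assms by (simp add: rot xs take_all)
  qed
qed

text \<open>
  Consider the walk \<open>s\<close> with steps \<open>x - 1\<close> for the entries \<open>x\<close>. Continued periodically, it drops by
  \<open>1\<close> in each period of length \<open>n + 1\<close>. The rotation by \<open>r\<close> satisfies the ballot condition iff the walk
  does not fall below \<open>s r\<close> during the period that starts at \<open>r\<close>; in the part that has wrapped
  around, the drop turns this into the strict inequality at the positions before \<open>r\<close>. So \<open>r\<close> must
  be the first place at which \<open>s\<close> is minimal.
\<close>
lemma rotate_in_ballot_lists_iff:
  assumes xs: "xs \<in> weak_compositions (Suc n) n" and r: "r \<le> n"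
  defines "s \<equiv> \<lambda>j. int (sum_list (take j xs)) - int j"
  shows "rotate r xs \<in> ballot_lists n \<longleftrightarrow>
    (\<forall>j\<le>n. (j < r \<longrightarrow> s r < s j) \<and> (r \<le> j \<longrightarrow> s r \<le> s j))"
    (is "_ \<longleftrightarrow> ?first_minimum")
proof -
  have len: "length xs = Suc n" and tot: "sum_list xs = n"
    using xs by (auto simp: weak_compositions_def)
  have mem: "rotate r xs \<in> ballot_lists n \<longleftrightarrow> (\<forall>j\<le>n. j \<le> sum_list (take j (rotate r xs)))"
    using len tot by (simp add: ballot_lists_def weak_compositions_def sum_list_rotate)
  have eq: "sum_list (take j (rotate r xs)) + sum_list (take r xs) =
      (if r + j \<le> n then sum_list (take (r + j) xs)
       else n + sum_list (take (r + j - Suc n) xs))" if "j \<le> n" for j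
    using sum_list_take_rotate[of r xs j] that r len tot by (simp add: less_Suc_eq_le)
  show ?thesis
    unfolding mem
  proof
    assume *: "\<forall>j\<le>n. j \<le> sum_list (take j (rotate r xs))"
    show ?first_minimum
    proof (intro allI impI conjI)
      fix j assume j: "j \<le> n" "j < r"
      then have "j + Suc n - r \<le> n" "r + (j + Suc n - r) = j + Suc n" using r by auto
      then show "s r < s j" using * eq[of "j + Suc n - r"] j unfolding s_def by fastforce
    next
      fix j assume j: "j \<le> n" "r \<le> j"
      then have "j - r \<le> n" "r + (j - r) = j" by auto
      then show "s r \<le> s j" using * eq[of "j - r"] j unfolding s_def by fastforce
    qed
  next
    assume *: ?first_minimum
    show "\<forall>j\<le>n. j \<le> sum_list (take j (rotate r xs))"
    proof (intro allI impI)
      fix j assume j: "j \<le> n"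
      show "j \<le> sum_list (take j (rotate r xs))"
      proof (cases "r + j \<le> n")
        case True
        then have "s r \<le> s (r + j)" using * by simp
        then show ?thesis using eq[OF j] True unfolding s_def by simp
      next
        case False
        then have "s r < s (r + j - Suc n)" using * j r by simp
        then show ?thesis using eq[OF j] False unfolding s_def by simp
      qed
    qed
  qed
qed

text \<open>
  A finite sequence has exactly one first minimum.
\<close>
lemma cycle_lemma:
  assumes xs: "xs \<in> weak_compositions (Suc n) n"
  shows "\<exists>!r. r \<le> n \<and> rotate r xs \<in> ballot_lists n"
proof -
  define s where "s = (\<lambda>j. int (sum_list (take j xs)) - int j)"
  have iff: "rotate r xs \<in> ballot_lists n \<longleftrightarrow>
      (\<forall>j\<le>n. (j < r \<longrightarrow> s r < s j) \<and> (r \<le> j \<longrightarrow> s r \<le> s j))" if "r \<le> n" for r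
    unfolding s_def by (rule rotate_in_ballot_lists_iff[OF xs that])
  define m where "m = Min (s ` {..n})"
  have mle: "m \<le> s j" if "j \<le> n" for j using that by (simp add: m_def)
  have "m \<in> s ` {..n}" unfolding m_def by (rule Min_in) auto
  then have ex: "\<exists>r. r \<le> n \<and> s r = m" by auto
  define r where "r = (LEAST r. r \<le> n \<and> s r = m)"
  have r: "r \<le> n" "s r = m" using LeastI_ex[OF ex] unfolding r_def by auto
  have "s j \<noteq> m" if "j < r" for j using not_less_Least[of j] that r(1) unfolding r_def by force
  then have "rotate r xs \<in> ballot_lists n"
    using iff[OF r(1)] mle r by (auto simp: order_less_le)
  moreover have "r' = r''" if "r' \<le> n" "rotate r' xs \<in> ballot_lists n"
    "r'' \<le> n" "rotate r'' xs \<in> ballot_lists n" for r' r''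
  proof (rule ccontr)
    assume "r' \<noteq> r''"
    then consider "r' < r''" | "r'' < r'" by linarith
    then show False
      using that iff[of r'] iff[of r''] by cases (metis less_imp_le not_less)+
  qed
  ultimately show ?thesis using r(1) by blast
qed

lemma bij_betw_rotate_weak_compositions:
  "bij_betw (rotate r) (weak_compositions N n) (weak_compositions N n)"
proof -
  have "inj (rotate r :: nat list \<Rightarrow> nat list)"
    unfolding rotate_def by (rule inj_fn[OF inj_rotate1])
  then have inj: "inj_on (rotate r) (weak_compositions N n)" by (rule inj_on_subset) simp
  moreover have "rotate r ` weak_compositions N n \<subseteq> weak_compositions N n"
    by (auto simp: weak_compositions_def sum_list_rotate)
  ultimately show ?thesis
    using endo_inj_surj[OF finite_weak_compositions] by (simp add: bij_betw_def)
qed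

text \<open>
  Sort the weak compositions by the rotation that turns them into a ballot list. Each of the \<open>n + 1\<close>
  classes is mapped bijectively to the ballot lists by its rotation.
\<close>
lemma card_weak_compositions_eq_ballot_lists:
  "card {xs \<in> weak_compositions (Suc n) n. Q (set xs)} = Suc n * card {xs \<in> ballot_lists n. Q (set xs)}"
proof -
  let ?W = "{xs \<in> weak_compositions (Suc n) n. Q (set xs)}"
  let ?L = "{xs \<in> ballot_lists n. Q (set xs)}"
  define A where "A = (\<lambda>r. {xs \<in> ?W. rotate r xs \<in> ballot_lists n})"
  have "?W = (\<Union>r\<in>{..n}. A r)" using cycle_lemma unfolding A_def by blast
  moreover have "card (\<Union>r\<in>{..n}. A r) = (\<Sum>r\<le>n. card (A r))"
  proof (rule card_UN_disjoint)
    show "\<forall>r\<in>{..n}. finite (A r)" using finite_weak_compositions by (simp add: A_def)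
    show "\<forall>r\<in>{..n}. \<forall>r'\<in>{..n}. r \<noteq> r' \<longrightarrow> A r \<inter> A r' = {}"
      using cycle_lemma unfolding A_def by blast
  qed simp
  moreover have "card (A r) = card ?L" for r
  proof (rule bij_betw_same_card[of "rotate r"])
    note bij = bij_betw_rotate_weak_compositions[of r "Suc n" n]
    have "rotate r ` A r = ?L"
    proof
      show "rotate r ` A r \<subseteq> ?L" by (auto simp: A_def)
      show "?L \<subseteq> rotate r ` A r"
      proof
        fix ys assume ys: "ys \<in> ?L"
        then have "ys \<in> rotate r ` weak_compositions (Suc n) n"
          using bij by (auto simp: bij_betw_def ballot_lists_def)
        then obtain xs where "xs \<in> weak_compositions (Suc n) n" "ys = rotate r xs" by blast
        then show "ys \<in> rotate r ` A r" using ys by (auto simp: A_def)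
      qed
    qed
    moreover have "inj_on (rotate r) (A r)"
      using bij by (rule inj_on_subset[OF bij_betw_imp_inj_on]) (auto simp: A_def)
    ultimately show "bij_betw (rotate r) (A r) ?L" by (simp add: bij_betw_def)
  qed
  ultimately show ?thesis by simp
qed

lemma card_noncrossing_partitions_by_sizes:
  "Suc n * card {P \<in> noncrossing_partitions n. Q (insert 0 (card ` P))} =
     card {xs \<in> weak_compositions (Suc n) n. Q (set xs)}"
proof -
  note bij = bij_betw_block_size_list[of n]
  have "block_size_list n ` {P \<in> noncrossing_partitions n. Q (insert 0 (card ` P))} =
      {xs \<in> ballot_lists n. Q (set xs)}" (is "_ ` ?A = ?B")
  proof
    show "block_size_list n ` ?A \<subseteq> ?B"
      using bij by (auto simp: set_block_size_list bij_betw_def)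
    show "?B \<subseteq> block_size_list n ` ?A"
    proof
      fix xs assume xs: "xs \<in> ?B"
      then have "xs \<in> block_size_list n ` noncrossing_partitions n"
        using bij by (simp add: bij_betw_def)
      then obtain P where "P \<in> noncrossing_partitions n" "xs = block_size_list n P" by blast
      then show "xs \<in> block_size_list n ` ?A" using xs by (auto simp: set_block_size_list)
    qed
  qed
  moreover have "inj_on (block_size_list n) ?A"
    using bij by (rule inj_on_subset[OF bij_betw_imp_inj_on]) auto
  ultimately have "card ?A = card ?B" using card_image[of "block_size_list n" ?A] by simp
  then show ?thesis by (simp add: card_weak_compositions_eq_ballot_lists del: mult_Suc)
qed

section \<open>Large parts of a random weak composition\<close>

text \<open>
  Subtracting \<open>k\<close> from the entries in \<open>I\<close> removes the lower bounds and leaves a weak composition of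
  \<open>n - k * card I\<close>.
\<close>
lemma card_weak_compositions_large_parts:
  assumes I: "I \<subseteq> {..<N}" and k: "k * card I \<le> n"
  shows "card {xs \<in> weak_compositions N n. \<forall>i\<in>I. k \<le> xs ! i} =
     (n - k * card I + N - 1) choose (n - k * card I)"
proof -
  define c where "c = (\<lambda>i. if i \<in> I then k else 0)"
  have sum_c: "sum c {..<N} = k * card I"
    using I by (simp add: c_def sum.If_cases Int_absorb1)
  define up where "up = (\<lambda>ys. map (\<lambda>i. ys ! i + c i) [0..<N])"
  define down where "down = (\<lambda>xs. map (\<lambda>i. xs ! i - c i) [0..<N])"
  have total: "sum_list xs = (\<Sum>i<N. xs ! i)" if "length xs = N" for xs :: "nat list"
    using that by (simp add: sum_list_sum_nth atLeast0LessThan)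
  have total_map: "sum_list (map h [0..<N]) = sum h {..<N}" for h :: "nat \<Rightarrow> nat"
    by (simp add: interv_sum_list_conv_sum_set_nat atLeast0LessThan)
  let ?V = "weak_compositions N (n - k * card I)"
  let ?X = "{xs \<in> weak_compositions N n. \<forall>i\<in>I. k \<le> xs ! i}"
  have "bij_betw up ?V ?X"
  proof (rule bij_betw_byWitness[where f' = down])
    show "\<forall>ys\<in>?V. down (up ys) = ys"
      by (auto simp: weak_compositions_def up_def down_def intro!: nth_equalityI)
    show "\<forall>xs\<in>?X. up (down xs) = xs"
      by (auto simp: weak_compositions_def up_def down_def c_def intro!: nth_equalityI)
    show "up ` ?V \<subseteq> ?X"
    proof (rule image_subsetI)
      fix ys assume "ys \<in> ?V"
      then have ys: "length ys = N" "sum_list ys = n - k * card I"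
        by (auto simp: weak_compositions_def)
      then have "sum_list (up ys) = n"
        using total[of ys] k sum_c by (simp add: up_def total_map sum.distrib)
      then show "up ys \<in> ?X" using I by (auto simp: weak_compositions_def up_def c_def)
    qed
    show "down ` ?X \<subseteq> ?V"
    proof (rule image_subsetI)
      fix xs assume "xs \<in> ?X"
      then have xs: "length xs = N" "sum_list xs = n" "\<And>i. i < N \<Longrightarrow> c i \<le> xs ! i"
        by (auto simp: weak_compositions_def c_def)
      then have "sum_list (down xs) = n - k * card I"
        using total[of xs] sum_c sum_subtractf_nat[of "{..<N}" c "(!) xs"]
        by (simp add: down_def total_map)
      then show "down xs \<in> ?V" by (simp add: weak_compositions_def down_def)
    qed
  qed
  then have "card ?X = card ?V" by (simp add: bij_betw_same_card)
  then show ?thesis by (simp add: card_weak_compositions)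
qed

lemma binomial_step: "(Suc m - n) * (Suc m choose n) = Suc m * (m choose n)"
  using binomial_absorb_comp[of "Suc m" n] by simp

text \<open>
  For \<open>m < 2 * n\<close>, the step from \<open>m choose n\<close> to \<open>m + 1 choose n\<close> multiplies by
  \<open>(m + 1) / (m + 1 - n) \<ge> 2\<close>.
\<close>
lemma binomial_halving:
  assumes "k \<le> n"
  shows "2 ^ k * ((2 * n - k) choose n) \<le> (2 * n) choose n"
  using assms
proof (induction k)
  case (Suc k)
  define m where "m = 2 * n - Suc k"
  have m: "Suc m = 2 * n - k" "n \<le> m" using Suc.prems by (auto simp: m_def)
  have "(Suc m - n) * (2 * (m choose n)) \<le> Suc m * (m choose n)"
    using m Suc.prems by (simp add: algebra_simps del: binomial_Suc_Suc)
  also have "\<dots> = (Suc m - n) * (Suc m choose n)" by (rule binomial_step[symmetric])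
  finally have "2 * (m choose n) \<le> Suc m choose n" using m(2) by (simp del: binomial_Suc_Suc)
  then have "2 ^ Suc k * (m choose n) \<le> 2 ^ k * (Suc m choose n)" by simp
  also have "\<dots> \<le> (2 * n) choose n" using Suc m by simp
  finally show ?case by (simp add: m_def)
qed simp

text \<open>
  Between \<open>2 * n - k\<close> and \<open>2 * n\<close>, each step down from \<open>m + 1 choose n\<close> to \<open>m choose n\<close> multiplies by
  \<open>(m + 1 - n) / (m + 1) \<ge> (n - k) / (2 * n)\<close>.
\<close>
lemma binomial_lower_decay:
  assumes "k \<le> n" "n > 0"
  shows "real ((2 * n) choose n) * ((1 - k / n) / 2) ^ k \<le> real ((2 * n - k) choose n)"
proof -
  define q where "q = (1 - real k / n) / 2"
  have q: "0 \<le> q" using assms by (simp add: q_def)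
  have "j \<le> k \<Longrightarrow> real ((2 * n) choose n) * q ^ j \<le> real ((2 * n - j) choose n)" for j
  proof (induction j)
    case (Suc j)
    define m where "m = 2 * n - Suc j"
    have m: "Suc m = 2 * n - j" "n \<le> m" using Suc.prems assms(1) by (auto simp: m_def)
    have step: "real (Suc m - n) * real (Suc m choose n) = real (Suc m) * real (m choose n)"
      using binomial_step[of m n] by (metis of_nat_mult)
    have "q * real (Suc m) \<le> q * (2 * n)" using q m by (intro mult_left_mono) auto
    also have "\<dots> = real n - k" using assms by (simp add: q_def field_simps)
    also have "\<dots> \<le> real (Suc m - n)" using m Suc.prems assms by linarith
    finally have *: "q * real (Suc m) \<le> real (Suc m - n)" .
    have "real (Suc m) * (q * real (Suc m choose n)) \<le> real (Suc m - n) * real (Suc m choose n)"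
      using mult_right_mono[OF *, of "real (Suc m choose n)"] by (simp add: mult_ac del: binomial_Suc_Suc)
    then have "q * real (Suc m choose n) \<le> real (m choose n)"
      unfolding step by (simp del: of_nat_Suc binomial_Suc_Suc)
    moreover have "real ((2 * n) choose n) * q ^ Suc j \<le> q * real (Suc m choose n)"
      using mult_left_mono[OF Suc.IH q] Suc.prems m by (simp add: mult_ac)
    ultimately show ?case by (simp add: m_def)
  qed simp
  from this[of k] show ?thesis by (simp add: q_def)
qed

text \<open>
  The growth factor \<open>(m + 1) / (m + 1 - n)\<close> decreases in \<open>m\<close>, so \<open>m choose n\<close> is log-concave in \<open>m\<close>.
  This is what makes large entries at different places negatively correlated.
\<close>
lemma binomial_ratio_decreasing:
  assumes "n \<le> m1" "m1 \<le> m2"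
  shows "((m2 + k) choose n) * (m1 choose n) \<le> ((m1 + k) choose n) * (m2 choose n)"
proof (induction k)
  case (Suc k)
  define x1 x2 where "x1 = m1 + k" and "x2 = m2 + k"
  have x: "n \<le> x1" "x1 \<le> x2" using assms by (auto simp: x1_def x2_def)
  define d1 d2 where "d1 = Suc x1 - n" and "d2 = Suc x2 - n"
  have pos: "d1 > 0" "d2 > 0" using x by (auto simp: d1_def d2_def)
  have s1: "d1 * (Suc x1 choose n) = Suc x1 * (x1 choose n)"
    and s2: "d2 * (Suc x2 choose n) = Suc x2 * (x2 choose n)"
    unfolding d1_def d2_def by (rule binomial_step)+
  have "Suc x2 * d1 \<le> Suc x1 * d2"
  proof -
    have "int (Suc x2) * int d1 \<le> int (Suc x1) * int d2"
      using x mult_left_mono[of "int x1" "int x2" "int n"]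
      by (simp add: d1_def d2_def of_nat_diff algebra_simps)
    then show ?thesis by (metis of_nat_le_iff of_nat_mult)
  qed
  then have "(Suc x2 * d1) * ((x2 choose n) * (m1 choose n)) \<le>
      (Suc x1 * d2) * ((x1 choose n) * (m2 choose n))"
    using Suc.IH unfolding x1_def x2_def by (rule mult_le_mono)
  then have "(d1 * d2) * ((Suc x2 choose n) * (m1 choose n)) \<le>
      (d1 * d2) * ((Suc x1 choose n) * (m2 choose n))"
    using s1 s2 by (metis mult.assoc mult.commute mult.left_commute)
  then show ?case using pos by (simp add: x1_def x2_def del: binomial_Suc_Suc)
qed (simp add: mult.commute)

text \<open>
  Chebyshev's inequality in counting form. Let \<open>X\<close> be the number of the sets \<open>A i\<close> that contain a
  uniformly random point of \<open>\<Omega>\<close>. The assumption on pairs says that the events are not positively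
  correlated, so the variance of \<open>X\<close> is at most its mean \<open>\<mu>\<close>, and \<open>X = 0\<close> has probability at most
  \<open>1 / \<mu>\<close>.
\<close>
lemma second_moment_count:
  fixes A :: "'i \<Rightarrow> 'a set"
  assumes fin: "finite \<Omega>" "finite I"
    and sub: "\<And>i. i \<in> I \<Longrightarrow> A i \<subseteq> \<Omega>"
    and single: "\<And>i. i \<in> I \<Longrightarrow> card (A i) = a"
    and pair: "\<And>i j. i \<in> I \<Longrightarrow> j \<in> I \<Longrightarrow> i \<noteq> j \<Longrightarrow> card \<Omega> * card (A i \<inter> A j) \<le> a\<^sup>2"
  shows "card (\<Omega> - (\<Union>i\<in>I. A i)) * (card I * a) \<le> (card \<Omega>)\<^sup>2"
proof (cases "card I * a = 0 \<or> \<Omega> = {}")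
  case False
  define X where "X = (\<lambda>\<omega>. \<Sum>i\<in>I. indicat_real (A i) \<omega>)"
  define M where "M = real (card \<Omega>)"
  define s where "s = real (card I) * real a"
  define Z where "Z = \<Omega> - (\<Union>i\<in>I. A i)"
  have M: "M > 0" using False fin by (simp add: M_def card_gt_0_iff)
  have s: "s > 0" using False by (simp add: s_def)
  have ind: "(\<Sum>\<omega>\<in>\<Omega>. indicat_real B \<omega>) = card B" if "B \<subseteq> \<Omega>" for B
    using that fin(1) by (simp add: sum_indicator_eq_card Int_absorb1 indicator_def sum.If_cases)
  have first: "sum X \<Omega> = s"
  proof -
    have "sum X \<Omega> = (\<Sum>i\<in>I. \<Sum>\<omega>\<in>\<Omega>. indicat_real (A i) \<omega>)"
      unfolding X_def by (rule sum.swap)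
    also have "\<dots> = s" using sub single by (simp add: ind s_def)
    finally show ?thesis .
  qed
  have second: "(\<Sum>\<omega>\<in>\<Omega>. (X \<omega>)\<^sup>2) \<le> s + s\<^sup>2 / M"
  proof -
    have "(\<Sum>\<omega>\<in>\<Omega>. (X \<omega>)\<^sup>2) = (\<Sum>\<omega>\<in>\<Omega>. \<Sum>i\<in>I. \<Sum>j\<in>I. indicat_real (A i \<inter> A j) \<omega>)"
      by (simp add: X_def power2_eq_square sum_product indicator_inter_arith)
    also have "\<dots> = (\<Sum>i\<in>I. \<Sum>\<omega>\<in>\<Omega>. \<Sum>j\<in>I. indicat_real (A i \<inter> A j) \<omega>)"
      by (rule sum.swap)
    also have "\<dots> = (\<Sum>i\<in>I. \<Sum>j\<in>I. \<Sum>\<omega>\<in>\<Omega>. indicat_real (A i \<inter> A j) \<omega>)"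
      by (intro sum.cong refl sum.swap)
    also have "\<dots> = (\<Sum>i\<in>I. \<Sum>j\<in>I. real (card (A i \<inter> A j)))"
      using sub by (intro sum.cong refl ind) blast
    also have "\<dots> \<le> (\<Sum>i\<in>I. \<Sum>j\<in>I. (if i = j then real a else 0) + (real a)\<^sup>2 / M)"
    proof (intro sum_mono)
      fix i j assume ij: "i \<in> I" "j \<in> I"
      show "real (card (A i \<inter> A j)) \<le> (if i = j then real a else 0) + (real a)\<^sup>2 / M"
      proof (cases "i = j")
        case False
        have "real (card \<Omega> * card (A i \<inter> A j)) \<le> real (a\<^sup>2)"
          using pair[OF ij False] by (simp only: of_nat_le_iff)
        then have "M * real (card (A i \<inter> A j)) \<le> (real a)\<^sup>2" by (simp add: M_def)
        then show ?thesis using False M by (simp add: field_simps)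
      qed (use single ij M in simp)
    qed
    also have "\<dots> = s + s\<^sup>2 / M"
      using fin(2) by (simp add: sum.distrib s_def power2_eq_square algebra_simps)
    finally show ?thesis .
  qed
  \<comment> \<open>\<open>s / M\<close> is the mean of \<open>X\<close>, and \<open>X\<close> vanishes on \<open>Z\<close>.\<close>
  have "card Z * (s / M)\<^sup>2 = (\<Sum>\<omega>\<in>Z. (X \<omega> - s / M)\<^sup>2)"
    by (simp add: Z_def X_def indicator_def)
  also have "\<dots> \<le> (\<Sum>\<omega>\<in>\<Omega>. (X \<omega> - s / M)\<^sup>2)"
    using fin(1) by (intro sum_mono2) (auto simp: Z_def)
  also have "\<dots> = (\<Sum>\<omega>\<in>\<Omega>. (X \<omega>)\<^sup>2) - 2 * (s / M) * sum X \<Omega> + M * (s / M)\<^sup>2"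
  proof -
    have "(\<Sum>\<omega>\<in>\<Omega>. (X \<omega> - s / M)\<^sup>2) = (\<Sum>\<omega>\<in>\<Omega>. (X \<omega>)\<^sup>2 - 2 * (s / M) * X \<omega> + (s / M)\<^sup>2)"
      by (intro sum.cong refl) (simp add: power2_diff)
    also have "\<dots> = (\<Sum>\<omega>\<in>\<Omega>. (X \<omega>)\<^sup>2) - 2 * (s / M) * sum X \<Omega> + M * (s / M)\<^sup>2"
      by (simp only: sum.distrib sum_subtractf sum_distrib_left sum_constant M_def)
    finally show ?thesis .
  qed
  also have "\<dots> \<le> s"
    using second M by (simp add: first power2_eq_square)
  finally have "(card Z * s) * s \<le> M\<^sup>2 * s"
    using M by (simp add: power_divide field_simps power2_eq_square)
  then have "card Z * s \<le> M\<^sup>2" using s by simp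
  then have "real (card Z * (card I * a)) \<le> real ((card \<Omega>)\<^sup>2)" by (simp add: s_def M_def)
  then show ?thesis unfolding Z_def by (simp only: of_nat_le_iff)
qed auto

lemma card_compositions_single:
  assumes "i \<le> n" "k \<le> n"
  shows "card {xs \<in> weak_compositions (Suc n) n. k \<le> xs ! i} = (2 * n - k) choose n"
proof -
  have "n - k + Suc n - 1 = 2 * n - k" using assms by simp
  moreover have "(2 * n - k) choose (n - k) = (2 * n - k) choose n"
    using binomial_symmetric[of "n - k" "2 * n - k"] assms by simp
  ultimately show ?thesis
    using card_weak_compositions_large_parts[of "{i}" "Suc n" k n] assms by simp
qed

lemma card_compositions_pair:
  assumes "i \<le> n" "j \<le> n" "i \<noteq> j" "2 * k \<le> n"
  shows "card {xs \<in> weak_compositions (Suc n) n. k \<le> xs ! i \<and> k \<le> xs ! j} =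
    (2 * n - 2 * k) choose n"
proof -
  have "n - 2 * k + Suc n - 1 = 2 * n - 2 * k" using assms by simp
  moreover have "(2 * n - 2 * k) choose (n - 2 * k) = (2 * n - 2 * k) choose n"
    using binomial_symmetric[of "n - 2 * k" "2 * n - 2 * k"] assms by simp
  ultimately show ?thesis
    using card_weak_compositions_large_parts[of "{i, j}" "Suc n" k n] assms
    by (simp add: mult_2 mult_2_right)
qed

text \<open>
  The union bound over the \<open>n + 1\<close> positions.
\<close>
lemma card_compositions_large_part_le:
  "2 ^ k * card {xs \<in> weak_compositions (Suc n) n. \<exists>x\<in>set xs. k \<le> x}
     \<le> Suc n * card (weak_compositions (Suc n) n)"
proof (cases "k \<le> n")
  case True
  let ?A = "\<lambda>i. {xs \<in> weak_compositions (Suc n) n. k \<le> xs ! i}"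
  have "{xs \<in> weak_compositions (Suc n) n. \<exists>x\<in>set xs. k \<le> x} \<subseteq> (\<Union>i\<in>{..n}. ?A i)"
    by (fastforce simp: in_set_conv_nth weak_compositions_def less_Suc_eq_le)
  then have "card {xs \<in> weak_compositions (Suc n) n. \<exists>x\<in>set xs. k \<le> x} \<le> card (\<Union>i\<in>{..n}. ?A i)"
    using finite_weak_compositions by (intro card_mono) auto
  also have "\<dots> \<le> (\<Sum>i\<le>n. card (?A i))" by (rule card_UN_le) simp
  also have "\<dots> = Suc n * ((2 * n - k) choose n)" using card_compositions_single True by simp
  finally have "2 ^ k * card {xs \<in> weak_compositions (Suc n) n. \<exists>x\<in>set xs. k \<le> x}
      \<le> 2 ^ k * (Suc n * ((2 * n - k) choose n))" by (rule mult_le_mono2)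
  also have "\<dots> = Suc n * (2 ^ k * ((2 * n - k) choose n))" by (simp only: mult_ac)
  also have "\<dots> \<le> Suc n * ((2 * n) choose n)" using binomial_halving[OF True] by (rule mult_le_mono2)
  finally show ?thesis by (simp add: card_weak_compositions mult_2)
next
  case False
  have "x \<le> n" if "xs \<in> weak_compositions (Suc n) n" "x \<in> set xs" for xs x
    using that member_le_sum_list[of x xs] by (simp add: weak_compositions_def)
  then have "{xs \<in> weak_compositions (Suc n) n. \<exists>x\<in>set xs. k \<le> x} = {}"
    using False by fastforce
  then show ?thesis by (simp only: card.empty)
qed

text \<open>
  The second moment bound, with one event for each position. Pairs satisfy its assumption
  by log-concavity, applied to \<open>2 * n - 2 * k\<close>, \<open>2 * n - k\<close> and \<open>2 * n\<close>.
\<close>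
lemma card_compositions_small_parts_le:
  assumes "2 * k \<le> n"
  shows "card {xs \<in> weak_compositions (Suc n) n. \<forall>x\<in>set xs. x < k} * (Suc n * ((2 * n - k) choose n))
     \<le> (card (weak_compositions (Suc n) n))\<^sup>2"
proof -
  let ?W = "weak_compositions (Suc n) n"
  let ?A = "\<lambda>i. {xs \<in> ?W. k \<le> xs ! i}"
  have "card (?W - (\<Union>i\<in>{..n}. ?A i)) * (card {..n} * ((2 * n - k) choose n)) \<le> (card ?W)\<^sup>2"
  proof (rule second_moment_count)
    fix i j assume ij: "i \<in> {..n}" "j \<in> {..n}" "i \<noteq> j"
    have "?A i \<inter> ?A j = {xs \<in> ?W. k \<le> xs ! i \<and> k \<le> xs ! j}" by auto
    then have "card (?A i \<inter> ?A j) = (2 * n - 2 * k) choose n"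
      using card_compositions_pair ij assms by simp
    moreover have "((2 * n) choose n) * ((2 * n - 2 * k) choose n) \<le> ((2 * n - k) choose n)\<^sup>2"
      using binomial_ratio_decreasing[of n "2 * n - 2 * k" "2 * n - k" k] assms
      by (simp add: power2_eq_square)
    ultimately show "card ?W * card (?A i \<inter> ?A j) \<le> ((2 * n - k) choose n)\<^sup>2"
      by (simp add: card_weak_compositions mult_2)
  qed (use finite_weak_compositions card_compositions_single assms in auto)
  moreover have "?W - (\<Union>i\<in>{..n}. ?A i) = {xs \<in> ?W. \<forall>x\<in>set xs. x < k}"
    by (auto simp: weak_compositions_def all_set_conv_all_nth not_le less_Suc_eq_le)
       (metis not_le)
  ultimately show ?thesis by simp
qed

section \<open>The largest block\<close>

lemma largest_block_size_ge_iff: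
  assumes "P \<in> noncrossing_partitions n" "n > 0" "k > 0"
  shows "k \<le> largest_block_size P \<longleftrightarrow> (\<exists>x\<in>insert 0 (card ` P). k \<le> x)"
proof -
  have P: "partition_on {1..n} P" using assms(1) by (simp add: noncrossing_partitions_def)
  then have "finite P" by (rule finite_elements[rotated]) simp
  moreover have "P \<noteq> {}" using P assms(2) by (auto simp: partition_on_def)
  ultimately show ?thesis
    using assms(3) by (simp add: largest_block_size_def Max_ge_iff)
qed

text \<open>
  The transfer principle: an event that depends only on the set of block sizes can be evaluated for a
  uniformly random weak composition instead. The added \<open>0\<close> is harmless for the events used below,
  which compare the sizes with a threshold \<open>k > 0\<close>.
\<close>
lemma prob_random_noncrossing_partition:
  assumes "\<And>P. P \<in> noncrossing_partitions n \<Longrightarrow> P \<in> E \<longleftrightarrow> Q (insert 0 (card ` P))"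
  shows "measure_pmf.prob (random_noncrossing_partition n) E =
    card {xs \<in> weak_compositions (Suc n) n. Q (set xs)} / card (weak_compositions (Suc n) n)"
proof -
  let ?NC = "noncrossing_partitions n"
  have eq: "?NC \<inter> E = {P \<in> ?NC. Q (insert 0 (card ` P))}" using assms by auto
  have "measure_pmf.prob (random_noncrossing_partition n) E = card (?NC \<inter> E) / card ?NC"
    unfolding random_noncrossing_partition_def
    by (rule measure_pmf_of_set[OF noncrossing_partitions_nonempty finite_noncrossing_partitions])
  also have "\<dots> = real (Suc n * card (?NC \<inter> E)) / real (Suc n * card ?NC)"
    by (simp only: of_nat_mult) simp
  also have "Suc n * card (?NC \<inter> E) = card {xs \<in> weak_compositions (Suc n) n. Q (set xs)}"
    unfolding eq by (rule card_noncrossing_partitions_by_sizes)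
  also have "Suc n * card ?NC = card (weak_compositions (Suc n) n)"
    using card_noncrossing_partitions_by_sizes[of n "\<lambda>_. True"] by simp
  finally show ?thesis .
qed

lemma card_weak_compositions_pos: "card (weak_compositions (Suc n) n) > 0"
  by (simp add: card_weak_compositions)

lemma prob_largest_block_ge:
  assumes "n > 0" "k > 0"
  shows "measure_pmf.prob (random_noncrossing_partition n) {P. k \<le> largest_block_size P}
     \<le> (real n + 1) / 2 ^ k"
proof -
  let ?W = "weak_compositions (Suc n) n"
  have "measure_pmf.prob (random_noncrossing_partition n) {P. k \<le> largest_block_size P} =
      card {xs \<in> ?W. \<exists>x\<in>set xs. k \<le> x} / card ?W"
    using largest_block_size_ge_iff[OF _ assms] by (intro prob_random_noncrossing_partition) simp
  moreover have "real (2 ^ k * card {xs \<in> ?W. \<exists>x\<in>set xs. k \<le> x}) \<le> real (Suc n * card ?W)"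
    using card_compositions_large_part_le by (simp only: of_nat_le_iff)
  then have "card {xs \<in> ?W. \<exists>x\<in>set xs. k \<le> x} / card ?W \<le> (real n + 1) / 2 ^ k"
    using card_weak_compositions_pos[of n] by (simp add: field_simps)
  ultimately show ?thesis by simp
qed

text \<open>
  The lower bound \<open>2 ^ (-k) * (1 - k / n) ^ k\<close> for the probability of a large entry is weakened to
  \<open>2 ^ (-k) * (1 - k\<^sup>2 / n)\<close> by Bernoulli's inequality.
\<close>
lemma prob_largest_block_less:
  assumes "k > 0" "2 * k \<le> n" "k\<^sup>2 < n"
  shows "measure_pmf.prob (random_noncrossing_partition n) {P. largest_block_size P < k}
     \<le> 2 ^ k / ((real n + 1) * (1 - (real k)\<^sup>2 / n))"
proof -
  let ?W = "weak_compositions (Suc n) n"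
  define M where "M = real (card ?W)"
  define Z where "Z = real (card {xs \<in> ?W. \<forall>x\<in>set xs. x < k})"
  define a where "a = real ((2 * n - k) choose n)"
  define q where "q = (1 - k / n) ^ k"
  have n: "n > 0" and M: "M > 0" using assms card_weak_compositions_pos[of n] by (auto simp: M_def)
  have c: "0 < 1 - (real k)\<^sup>2 / n"
  proof -
    have "real (k\<^sup>2) < real n" using assms(3) by (simp only: of_nat_less_iff)
    then show ?thesis using n by simp
  qed
  have q: "1 - (real k)\<^sup>2 / n \<le> q"
    using Bernoulli_inequality[of "- (k / n)" k] assms n by (simp add: q_def power2_eq_square)
  have "M * (q / 2 ^ k) \<le> a"
    using binomial_lower_decay[of k n] assms n
    by (simp add: M_def a_def q_def card_weak_compositions mult_2 power_divide)
  then have "M * ((1 - (real k)\<^sup>2 / n) / 2 ^ k) \<le> a"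
    using mult_left_mono[OF divide_right_mono[OF q, of "2 ^ k"], of M] M by simp
  then have "Z * ((real n + 1) * (M * ((1 - (real k)\<^sup>2 / n) / 2 ^ k))) \<le> Z * ((real n + 1) * a)"
    by (intro mult_left_mono) (auto simp: Z_def)
  also have "\<dots> \<le> M\<^sup>2"
  proof -
    have "real (card {xs \<in> ?W. \<forall>x\<in>set xs. x < k} * (Suc n * ((2 * n - k) choose n)))
        \<le> real ((card ?W)\<^sup>2)"
      using card_compositions_small_parts_le[OF assms(2)] by (simp only: of_nat_le_iff)
    then show ?thesis by (simp add: Z_def M_def a_def algebra_simps)
  qed
  finally have "M * (Z * ((real n + 1) * (1 - (real k)\<^sup>2 / n)) / 2 ^ k) \<le> M * M"
    by (simp add: mult_ac power2_eq_square)
  then have "Z * ((real n + 1) * (1 - (real k)\<^sup>2 / n)) / 2 ^ k \<le> M" using M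
    by (rule mult_left_le_imp_le)
  then have "Z / M \<le> 2 ^ k / ((real n + 1) * (1 - (real k)\<^sup>2 / n))"
    using M c by (simp add: divide_le_eq le_divide_eq mult_ac)
  moreover have "measure_pmf.prob (random_noncrossing_partition n) {P. largest_block_size P < k} = Z / M"
    unfolding Z_def M_def
  proof (rule prob_random_noncrossing_partition)
    fix P assume "P \<in> noncrossing_partitions n"
    from largest_block_size_ge_iff[OF this n assms(1)]
    show "P \<in> {P. largest_block_size P < k} \<longleftrightarrow> (\<forall>x\<in>insert 0 (card ` P). x < k)"
      by (simp only: mem_Collect_eq not_le[symmetric]) blast
  qed
  ultimately show ?thesis by simp
qed

text \<open>
  At the threshold, \<open>2 ^ k\<close> is at least \<open>n powr (1 + \<delta>)\<close>, which beats the factor \<open>n + 1\<close> of the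
  union bound.
\<close>
lemma prob_largest_block_ge_tendsto_0:
  assumes "\<delta> > 0"
  shows "(\<lambda>n. measure_pmf.prob (random_noncrossing_partition n)
      {P. nat \<lceil>(1 + \<delta>) * log 2 n\<rceil> \<le> largest_block_size P}) \<longlonglongrightarrow> 0"
proof (rule tendsto_sandwich[OF _ _ tendsto_const])
  show "(\<lambda>n. (real n + 1) / n powr (1 + \<delta>)) \<longlonglongrightarrow> 0"
    using assms by real_asymp
  show "\<forall>\<^sub>F n in sequentially. measure_pmf.prob (random_noncrossing_partition n)
      {P. nat \<lceil>(1 + \<delta>) * log 2 n\<rceil> \<le> largest_block_size P} \<le> (real n + 1) / n powr (1 + \<delta>)"
    using eventually_ge_at_top[of 2]
  proof eventually_elim
    case (elim n)
    define k where "k = nat \<lceil>(1 + \<delta>) * log 2 n\<rceil>"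
    have pos: "(1 + \<delta>) * log 2 n > 0" using elim assms by simp
    then have k: "k > 0" "(1 + \<delta>) * log 2 n \<le> k" by (auto simp: k_def)
    have "n powr (1 + \<delta>) = 2 powr ((1 + \<delta>) * log 2 n)"
      using elim by (simp add: powr_powr[symmetric] mult.commute[of "1 + \<delta>"])
    also have "\<dots> \<le> 2 powr k" using k(2) by simp
    finally have "n powr (1 + \<delta>) \<le> 2 ^ k" by (simp add: powr_realpow)
    then have "(real n + 1) / 2 ^ k \<le> (real n + 1) / n powr (1 + \<delta>)"
      using elim by (intro divide_left_mono) auto
    then show ?case
      using prob_largest_block_ge[of n k] k(1) elim unfolding k_def by simp
  qed
qed simp

text \<open>
  Rounding up costs at most a factor \<open>2\<close>, so \<open>2 ^ k\<close> is at most \<open>2 * n powr (1 - \<delta>)\<close>, while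
  \<open>k\<^sup>2 / n\<close> tends to \<open>0\<close>.
\<close>
lemma prob_largest_block_less_tendsto_0:
  assumes "0 < \<delta>" "\<delta> < 1"
  shows "(\<lambda>n. measure_pmf.prob (random_noncrossing_partition n)
      {P. largest_block_size P < nat \<lceil>(1 - \<delta>) * log 2 n\<rceil>}) \<longlonglongrightarrow> 0"
proof (rule tendsto_sandwich[OF _ _ tendsto_const])
  let ?u = "\<lambda>n::nat. 2 * n powr (1 - \<delta>) / ((real n + 1) * (1 - (log 2 n + 1)\<^sup>2 / n))"
  show "?u \<longlonglongrightarrow> 0"
    using assms by real_asymp
  have "\<forall>\<^sub>F n::nat in sequentially. 2 * (log 2 n + 1) \<le> n" by real_asymp
  moreover have "\<forall>\<^sub>F n::nat in sequentially. (log 2 n + 1)\<^sup>2 < n" by real_asymp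
  ultimately show "\<forall>\<^sub>F n in sequentially. measure_pmf.prob (random_noncrossing_partition n)
      {P. largest_block_size P < nat \<lceil>(1 - \<delta>) * log 2 n\<rceil>} \<le> ?u n"
    using eventually_ge_at_top[of 2]
  proof eventually_elim
    case (elim n)
    define k where "k = nat \<lceil>(1 - \<delta>) * log 2 n\<rceil>"
    have pos: "(1 - \<delta>) * log 2 n > 0" using elim assms by simp
    then have k0: "k > 0" by (simp add: k_def)
    have k1: "k \<le> (1 - \<delta>) * log 2 n + 1" using pos unfolding k_def by linarith
    have "(1 - \<delta>) * log 2 n \<le> log 2 n" using elim assms by (simp add: mult_left_le_one_le)
    then have k2: "k \<le> log 2 n + 1" using k1 by linarith
    then have sq: "(real k)\<^sup>2 \<le> (log 2 n + 1)\<^sup>2" by (intro power_mono) auto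
    then have "real (k\<^sup>2) < real n" unfolding of_nat_power using elim(2) by linarith
    then have k3: "k\<^sup>2 < n" by (simp only: of_nat_less_iff)
    have "2 * real k \<le> real n" using k2 elim(1) by argo
    then have k4: "2 * k \<le> n" by linarith
    have "2 ^ k = 2 powr k" by (simp add: powr_realpow)
    also have "\<dots> \<le> 2 powr ((1 - \<delta>) * log 2 n + 1)" using k1 by simp
    also have "\<dots> = 2 * n powr (1 - \<delta>)"
      using elim by (simp add: powr_add powr_powr[symmetric] mult.commute[of "1 - \<delta>"])
    finally have num: "2 ^ k \<le> 2 * n powr (1 - \<delta>)" .
    have "measure_pmf.prob (random_noncrossing_partition n) {P. largest_block_size P < k}
        \<le> 2 ^ k / ((real n + 1) * (1 - (real k)\<^sup>2 / n))"
      using prob_largest_block_less[OF k0 k4 k3] by (simp add: add.commute)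
    also have "\<dots> \<le> ?u n"
    proof (rule frac_le)
      show "0 < (real n + 1) * (1 - (log 2 n + 1)\<^sup>2 / n)" using elim by simp
      show "(real n + 1) * (1 - (log 2 n + 1)\<^sup>2 / n) \<le> (real n + 1) * (1 - (real k)\<^sup>2 / n)"
        using sq by (intro mult_left_mono diff_left_mono divide_right_mono) auto
    qed (use num in auto)
    finally show ?case by (simp add: k_def)
  qed
qed simp

theorem theorem2p9:
  shows "tendsto_in_probability
           (\<lambda>n. measure_pmf (random_noncrossing_partition n))
           (\<lambda>n P. real (largest_block_size P) / log 2 (real n)) 1"
  unfolding tendsto_in_probability_def
proof (intro conjI allI impI)
  fix n
  show "prob_space (measure_pmf (random_noncrossing_partition n))" by (rule prob_space_measure_pmf)
  show "(\<lambda>P. real (largest_block_size P) / log 2 (real n))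
      \<in> borel_measurable (measure_pmf (random_noncrossing_partition n))" by simp
next
  fix \<epsilon> :: real assume "\<epsilon> > 0"
  \<comment> \<open>Deviations downwards by more than \<open>1\<close> are impossible; the cap keeps \<open>1 - \<delta>\<close> positive.\<close>
  define \<delta> where "\<delta> = min \<epsilon> (1 / 2)"
  have \<delta>: "0 < \<delta>" "\<delta> < 1" "\<delta> \<le> \<epsilon>" using \<open>\<epsilon> > 0\<close> by (auto simp: \<delta>_def)
  let ?p = "\<lambda>n. measure_pmf.prob (random_noncrossing_partition n)"
  let ?hi = "\<lambda>n::nat. {P. nat \<lceil>(1 + \<delta>) * log 2 n\<rceil> \<le> largest_block_size P}"
  let ?lo = "\<lambda>n::nat. {P. largest_block_size P < nat \<lceil>(1 - \<delta>) * log 2 n\<rceil>}"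
  let ?E = "\<lambda>n. {P \<in> space (measure_pmf (random_noncrossing_partition n)).
      \<epsilon> < \<bar>real (largest_block_size P) / log 2 (real n) - 1\<bar>}"
  show "(\<lambda>n. ?p n (?E n)) \<longlonglongrightarrow> 0"
  proof (rule tendsto_sandwich[OF _ _ tendsto_const])
    show "(\<lambda>n. ?p n (?hi n) + ?p n (?lo n)) \<longlonglongrightarrow> 0"
      using tendsto_add[OF prob_largest_block_ge_tendsto_0 prob_largest_block_less_tendsto_0] \<delta>
      by simp
    show "\<forall>\<^sub>F n in sequentially. ?p n (?E n) \<le> ?p n (?hi n) + ?p n (?lo n)"
      using eventually_ge_at_top[of 2]
    proof eventually_elim
      case (elim n)
      have l: "log 2 n > 0" using elim by simp
      have "?E n \<subseteq> ?hi n \<union> ?lo n"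
      proof
        fix P assume "P \<in> ?E n"
        then have "\<delta> < \<bar>real (largest_block_size P) / log 2 n - 1\<bar>" using \<delta>(3) by simp
        then consider "1 + \<delta> < real (largest_block_size P) / log 2 n"
          | "real (largest_block_size P) / log 2 n < 1 - \<delta>" by linarith
        then show "P \<in> ?hi n \<union> ?lo n"
        proof cases
          case 1
          then have "(1 + \<delta>) * log 2 n < largest_block_size P" using l by (simp add: less_divide_eq)
          then show ?thesis by simp
        next
          case 2
          then have "largest_block_size P < (1 - \<delta>) * log 2 n" using l by (simp add: divide_less_eq)
          then show ?thesis by simp linarith
        qed
      qed
      then have "?p n (?E n) \<le> ?p n (?hi n \<union> ?lo n)" by (intro measure_pmf.finite_measure_mono) auto
      also have "\<dots> \<le> ?p n (?hi n) + ?p n (?lo n)"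
        by (rule measure_Un_le) auto
      finally show ?case .
    qed
  qed simp
qed

end
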